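(* Put $$B_{\mathrm{exp}}(k)=\frac{208k^3+3615k^2-871k-1278}{1674}.$$ Every $(P_2\cup P_3)$-free graph $G$ with $k=\omega(G)\ge2$ satisfies $\chi(G)\le B_{\mathrm{exp}}(k)$. Moreover, for integers $k\ge8$, one has $B_{\mathrm{exp}}(k)<U_8(k)$ if and only if $k\ge1222$, where $$U_8(k)=\binom{k+2}{3}-S(k),\qquad S(k)=\begin{cases}(k-5)(k-6)(k-7)/24,&k\text{ odd},\\(k-4)(k-6)(k-8)/24,&k\text{ even}.\end{cases}$$
   Context: All graphs are finite, simple and undirected. $\chi(G)$ and $\omega(G)$ denote the chromatic number and the clique number of $G$. $P_t$ is the path on $t$ vertices, and $P_2\cup P_3$ is the graph consisting of an edge and a three-vertex path with no vertices in common and no edges between them. A graph is $H$-free if it has no induced subgraph isomorphic to $H$. *)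

theory Defs
  imports Complex_Main "Graph_Theory.Digraph_Isomorphism" "Graph_Theory.Pair_Digraph"
begin

text \<open>Finite simple undirected graphs are the symmetric loop-free finite digraphs of
  \<^locale>\<open>pair_graph\<close>: the edge \<open>uv\<close> is the pair of arcs \<open>(u, v)\<close> and \<open>(v, u)\<close>.\<close>

definition clique :: "'a pair_pre_digraph \<Rightarrow> 'a set \<Rightarrow> bool" where
  "clique G S \<longleftrightarrow> S \<subseteq> pverts G \<and> pairwise (\<lambda>u v. (u, v) \<in> parcs G) S"

definition clique_number :: "'a pair_pre_digraph \<Rightarrow> nat" (\<open>\<omega>\<close>) where
  "\<omega> G = Max {card S | S. clique G S}"

definition proper_colouring :: "'a pair_pre_digraph \<Rightarrow> nat \<Rightarrow> ('a \<Rightarrow> nat) \<Rightarrow> bool" where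
  "proper_colouring G n c \<longleftrightarrow>
    (\<forall>v \<in> pverts G. c v < n) \<and> (\<forall>(u, v) \<in> parcs G. c u \<noteq> c v)"

definition chromatic_number :: "'a pair_pre_digraph \<Rightarrow> nat" (\<open>\<chi>\<close>) where
  "\<chi> G = (LEAST n. \<exists>c. proper_colouring G n c)"

definition free_of :: "'a pair_pre_digraph \<Rightarrow> 'b pair_pre_digraph \<Rightarrow> bool" where
  "free_of H G \<longleftrightarrow>
    \<not> (\<exists>W. induced_subgraph W (with_proj G) \<and> digraph_iso W (with_proj H))"

definition path_graph :: "nat \<Rightarrow> nat pair_pre_digraph" where
  "path_graph t = \<lparr> pverts = {..<t},
     parcs = {(i, j). i < t \<and> j < t \<and> (j = Suc i \<or> i = Suc j)} \<rparr>"

definition disjoint_union ::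
    "'a pair_pre_digraph \<Rightarrow> 'b pair_pre_digraph \<Rightarrow> ('a + 'b) pair_pre_digraph" where
  "disjoint_union G H = \<lparr> pverts = pverts G <+> pverts H,
     parcs = map_prod Inl Inl ` parcs G \<union> map_prod Inr Inr ` parcs H \<rparr>"

definition P2_union_P3 :: "(nat + nat) pair_pre_digraph" where
  "P2_union_P3 = disjoint_union (path_graph 2) (path_graph 3)"

definition B_exp :: "nat \<Rightarrow> real" where
  "B_exp k = (208 * real k ^ 3 + 3615 * real k ^ 2 - 871 * real k - 1278) / 1674"

definition S_term :: "nat \<Rightarrow> real" where
  "S_term k = (if odd k then (real k - 5) * (real k - 6) * (real k - 7) / 24
               else (real k - 4) * (real k - 6) * (real k - 8) / 24)"

definition U8 :: "nat \<Rightarrow> real" where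
  "U8 k = real ((k + 2) choose 3) - S_term k"

end

theory Submission
  imports Defs
begin

text \<open>
  Let \<open>k\<close> be the clique number. In a \<open>(P\<^sub>2 \<union> P\<^sub>3)\<close>-free graph the common non-neighbours of the ends
  of an edge induce a disjoint union of cliques. Fix a maximum clique \<open>v 0, \<dots>, v (k - 1)\<close>.
  Vertices missing only one of its members form \<open>k\<close> independent sets with the members themselves,
  and every other vertex is put into a class \<open>C i j\<close> according to the first two members that it
  misses (\<open>clique_cover\<close>). Each \<open>C i j\<close> is a disjoint union of cliques of size at most
  \<open>k + 1 - j\<close>, which already gives the bound \<open>(k + 2) choose 3\<close>, of order \<open>k\<^sup>3 / 6\<close>.

  To improve the leading constant put \<open>b = \<lceil>k / 3\<rceil>\<close> and ask whether there are two edges and a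
  clique \<open>Q\<close> of size \<open>b\<close>, pairwise anticomplete.

  If there are, forbidden subgraphs force every vertex either to miss at most one vertex of \<open>Q\<close> or
  to belong to a \<open>P\<^sub>3\<close>-free set, which costs only \<open>k\<close> colours
  (\<open>colourable_if_anticomplete_edges_and_clique\<close>). A set \<open>X\<close> nearly complete to \<open>Q\<close> is cheap
  (\<open>near_complete_colourable\<close>): with \<open>p = k + 1 - b\<close>, one part of \<open>X\<close> with cliques of size at
  most \<open>p\<close> costs about \<open>p\<^sup>3 / 6\<close>, and the remaining vertices fall into \<open>b - 1\<close>
  non-neighbourhoods of vertices of \<open>Q\<close> costing about \<open>p\<^sup>2 / 2\<close> each. The total is
  \<open>10 k\<^sup>3 / 81\<close> up to lower order terms.

  If there are not, any \<open>C i j\<close> with a clique of size at least \<open>b\<close> is a single clique together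
  with an independent set. The large cliques can be coloured with about half as many colours as they
  have vertices, because a graph without large cliques has a large matching of non-adjacent pairs; the
  other classes cost less than \<open>b\<close> each
  (\<open>colourable_if_no_anticomplete_edges_and_clique\<close>). The total is \<open>13 k\<^sup>3 / 108\<close> up to lower
  order terms.

  The lower order terms are small enough for both totals to stay below \<open>B_exp k\<close> for every
  \<open>k \<ge> 4\<close>, and for \<open>k = 2, 3\<close> the binomial bound suffices. The comparison of \<open>B_exp\<close> with
  \<open>U8\<close> is a sign analysis of one cubic for each parity of \<open>k\<close>.
\<close>

section \<open>Colourings and cliques\<close>

text \<open>A graph is represented by its adjacency relation on a whole type. Vertex sets are arbitrary
  finite sets \<open>S\<close>, standing for the subgraphs that they induce.\<close>

locale simple_adjacency =
  fixes E :: "'a \<Rightarrow> 'a \<Rightarrow> bool"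
  assumes sym: "E x y \<Longrightarrow> E y x"
    and irrefl: "\<not> E x x"
begin

text \<open>The graph induced on \<open>S\<close> has a proper colouring with \<open>n\<close> colours.\<close>

definition colourable :: "'a set \<Rightarrow> nat \<Rightarrow> bool" where
  "colourable S n \<longleftrightarrow>
    (\<exists>c :: 'a \<Rightarrow> nat. (\<forall>v\<in>S. c v < n) \<and> (\<forall>u\<in>S. \<forall>v\<in>S. E u v \<longrightarrow> c u \<noteq> c v))"

text \<open>The vertices of \<open>K\<close> are pairwise adjacent.\<close>

definition is_clique :: "'a set \<Rightarrow> bool" where
  "is_clique K \<longleftrightarrow> (\<forall>u\<in>K. \<forall>v\<in>K. u \<noteq> v \<longrightarrow> E u v)"

text \<open>For finite \<open>S\<close> this says that the clique number of the graph induced on \<open>S\<close> is at most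
  \<open>n\<close>.\<close>

definition cliques_le :: "'a set \<Rightarrow> nat \<Rightarrow> bool" where
  "cliques_le S n \<longleftrightarrow> (\<forall>K\<subseteq>S. is_clique K \<longrightarrow> card K \<le> n)"

text \<open>The graph induced on \<open>S\<close> contains no induced path on three vertices.\<close>

definition P3_free :: "'a set \<Rightarrow> bool" where
  "P3_free S \<longleftrightarrow> (\<forall>x\<in>S. \<forall>y\<in>S. \<forall>z\<in>S. E x y \<longrightarrow> E y z \<longrightarrow> x \<noteq> z \<longrightarrow> E x z)"

lemma is_clique_subset: "is_clique K \<Longrightarrow> L \<subseteq> K \<Longrightarrow> is_clique L"
  by (auto simp: is_clique_def)

lemma is_clique_Un:
  assumes "is_clique K" "is_clique L" "\<And>x y. x \<in> K \<Longrightarrow> y \<in> L \<Longrightarrow> E x y"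
  shows "is_clique (K \<union> L)"
  using assms sym unfolding is_clique_def by blast

lemma cliques_leD: "cliques_le S n \<Longrightarrow> K \<subseteq> S \<Longrightarrow> is_clique K \<Longrightarrow> card K \<le> n"
  by (simp add: cliques_le_def)

lemma cliques_le_mono: "cliques_le S m \<Longrightarrow> T \<subseteq> S \<Longrightarrow> m \<le> n \<Longrightarrow> cliques_le T n"
  unfolding cliques_le_def by (meson order_trans)

lemma cliques_le_1_independent:
  assumes "cliques_le S 1" "x \<in> S" "y \<in> S"
  shows "\<not> E x y"
proof
  assume "E x y"
  then have "x \<noteq> y" using irrefl by auto
  moreover have "is_clique {x, y}" using \<open>E x y\<close> sym by (auto simp: is_clique_def)
  ultimately show False using cliques_leD[OF assms(1), of "{x, y}"] assms(2,3) by auto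
qed

lemma obtain_max_clique:
  assumes "finite S"
  obtains K where "K \<subseteq> S" "is_clique K" "cliques_le S (card K)"
proof -
  have "\<exists>K. (K \<subseteq> S \<and> is_clique K) \<and> (\<forall>L. L \<subseteq> S \<and> is_clique L \<longrightarrow> card L \<le> card K)"
    using ex_has_greatest_nat[of "\<lambda>K. K \<subseteq> S \<and> is_clique K" "{}" card "Suc (card S)"] assms
    by (simp add: is_clique_def card_mono le_imp_less_Suc)
  then obtain K where "(K \<subseteq> S \<and> is_clique K) \<and>
    (\<forall>L. L \<subseteq> S \<and> is_clique L \<longrightarrow> card L \<le> card K)" ..
  then show thesis using that[of K] by (simp add: cliques_le_def)
qed

lemma colourable_mono: "colourable S m \<Longrightarrow> T \<subseteq> S \<Longrightarrow> m \<le> n \<Longrightarrow> colourable T n"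
proof -
  assume "colourable S m" and T: "T \<subseteq> S" and n: "m \<le> n"
  then obtain c where "\<forall>v\<in>S. c v < m" "\<forall>u\<in>S. \<forall>v\<in>S. E u v \<longrightarrow> c u \<noteq> c v"
    unfolding colourable_def by blast
  then show ?thesis
    unfolding colourable_def using T n by (intro exI[of _ c]) fastforce
qed

lemma colourable_empty: "colourable {} n"
  by (simp add: colourable_def)

lemma colourable_Un:
  assumes "colourable S m" "colourable T n"
  shows "colourable (S \<union> T) (m + n)"
proof -
  obtain c where c: "\<forall>v\<in>S. c v < m" "\<forall>u\<in>S. \<forall>v\<in>S. E u v \<longrightarrow> c u \<noteq> c v"
    using assms(1) unfolding colourable_def by blast
  obtain d where d: "\<forall>v\<in>T. d v < n" "\<forall>u\<in>T. \<forall>v\<in>T. E u v \<longrightarrow> d u \<noteq> d v"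
    using assms(2) unfolding colourable_def by blast
  let ?e = "\<lambda>v. if v \<in> S then c v else m + d v"
  have "\<forall>v\<in>S \<union> T. ?e v < m + n" using c(1) d(1) by (auto simp: trans_less_add1)
  moreover have "\<forall>u\<in>S \<union> T. \<forall>v\<in>S \<union> T. E u v \<longrightarrow> ?e u \<noteq> ?e v"
  proof (intro ballI impI)
    fix u v assume uv: "u \<in> S \<union> T" "v \<in> S \<union> T" "E u v"
    show "?e u \<noteq> ?e v"
    proof (cases "u \<in> S"; cases "v \<in> S")
      assume "u \<in> S" "v \<notin> S"
      then have "c u < m" using c by blast
      then show ?thesis using \<open>u \<in> S\<close> \<open>v \<notin> S\<close> by simp
    next
      assume "u \<notin> S" "v \<in> S"
      then have "c v < m" using c by blast
      then show ?thesis using \<open>u \<notin> S\<close> \<open>v \<in> S\<close> by simp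
    qed (use uv c d in auto)
  qed
  ultimately show ?thesis unfolding colourable_def by (intro exI[of _ ?e] conjI)
qed

lemma colourable_UN:
  assumes "finite I" "\<And>i. i \<in> I \<Longrightarrow> colourable (S i) (n i)"
  shows "colourable (\<Union>i\<in>I. S i) (\<Sum>i\<in>I. n i)"
  using assms
proof (induction I rule: finite_induct)
  case empty
  then show ?case by (simp add: colourable_empty)
next
  case (insert i I)
  then have "colourable (S i \<union> (\<Union>i\<in>I. S i)) (n i + (\<Sum>i\<in>I. n i))"
    by (intro colourable_Un) auto
  then show ?case using insert by simp
qed

text \<open>The components of a \<open>P\<^sub>3\<close>-free set are cliques, so it needs no more colours than its
  largest clique has vertices.\<close>

lemma P3_free_colourable:
  assumes "finite S" "P3_free S" "cliques_le S n"
  shows "colourable S n"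
proof -
  define cl where "cl x = {y \<in> S. y = x \<or> E x y}" for x
  have trans: "E x z" if "x \<in> S" "y \<in> S" "z \<in> S" "E x y" "E y z" "x \<noteq> z" for x y z
    using assms(2) that unfolding P3_free_def by blast
  have cl_eq: "cl u = cl v" if "u \<in> S" "v \<in> S" "E u v" for u v
    unfolding cl_def using trans that sym by blast
  have "is_clique (cl x)" if "x \<in> S" for x
    unfolding is_clique_def cl_def using trans that sym by blast
  then have "card (cl x) \<le> n" if "x \<in> S" for x
    using cliques_leD[OF assms(3)] that unfolding cl_def by simp
  then have "\<exists>g. inj_on g (cl x) \<and> g ` cl x \<subseteq> {..<n}" if "x \<in> S" for x
    using card_le_inj[of "cl x" "{..<n}"] that assms(1) by (auto simp: cl_def)
  then have "\<exists>g. inj_on g C \<and> g ` C \<subseteq> {..<n}" if "C \<in> cl ` S" for C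
    using that by auto
  then obtain g :: "'a set \<Rightarrow> 'a \<Rightarrow> nat"
    where g: "\<And>C. C \<in> cl ` S \<Longrightarrow> inj_on (g C) C \<and> g C ` C \<subseteq> {..<n}"
    by metis
  let ?c = "\<lambda>x. g (cl x) x"
  have "?c v < n" if "v \<in> S" for v
    using g[of "cl v"] that by (auto simp: cl_def)
  moreover have "?c u \<noteq> ?c v" if "u \<in> S" "v \<in> S" "E u v" for u v
  proof -
    have "inj_on (g (cl u)) (cl u)" "u \<in> cl u" "v \<in> cl u" "u \<noteq> v"
      using g[of "cl u"] that irrefl by (auto simp: cl_def)
    then show ?thesis using cl_eq[OF that] by (metis inj_on_eq_iff)
  qed
  ultimately show ?thesis
    unfolding colourable_def by (intro exI[of _ ?c] conjI ballI impI)
qed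

lemma independent_colourable:
  assumes "\<And>x y. x \<in> S \<Longrightarrow> y \<in> S \<Longrightarrow> \<not> E x y"
  shows "colourable S 1"
  using assms unfolding colourable_def by (intro exI[of _ "\<lambda>_. 0"]) auto

text \<open>Colour classes of size two: a maximal matching of non-adjacent pairs leaves a clique.\<close>

lemma colourable_half_card:
  assumes "finite S" "cliques_le S k"
  shows "colourable S ((card S + k) div 2)"
  using assms
proof (induction "card S" arbitrary: S rule: less_induct)
  case less
  show ?case
  proof (cases "is_clique S")
    case True
    have "card S \<le> k" using cliques_leD[OF less.prems(2) _ True] by simp
    moreover have "colourable S (card S)"
      using less.prems True
      by (intro P3_free_colourable)
        (auto simp: P3_free_def is_clique_def cliques_le_def card_mono)
    ultimately show ?thesis by (auto elim!: colourable_mono)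
  next
    case False
    then obtain u v where uv: "u \<in> S" "v \<in> S" "u \<noteq> v" "\<not> E u v"
      unfolding is_clique_def by blast
    let ?T = "S - {u, v}"
    have "card {u, v} \<le> card S" using uv less.prems(1) by (intro card_mono) auto
    then have card: "card S = card ?T + 2" using uv by (simp add: card_Diff_subset)
    have "colourable ?T ((card ?T + k) div 2)"
      using less card cliques_le_mono[of S k ?T k] by auto
    moreover have "colourable {u, v} 1"
      using uv irrefl sym by (intro independent_colourable) auto
    ultimately have "colourable (?T \<union> {u, v}) ((card ?T + k) div 2 + 1)"
      by (rule colourable_Un)
    moreover have "?T \<union> {u, v} = S" using uv by auto
    moreover have "(card ?T + k) div 2 + 1 = (card S + k) div 2" using card by simp
    ultimately show ?thesis by simp
  qed
qed

end

section \<open>Sums and binomial coefficients\<close>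

lemma sum_mult_diff_real:
  "6 * (\<Sum>j<n. real j * (x - real j)) = 3 * x * real n * (real n - 1)
     - real n * (real n - 1) * (2 * real n - 1)"
  by (induction n) (simp_all add: algebra_simps)

lemma sum_mult_diff:
  assumes "m \<le> n"
  shows "6 * real (\<Sum>j<n. j * (m - j)) = real m ^ 3 - real m"
proof -
  have "(\<Sum>j<n. j * (m - j)) = (\<Sum>j<m. j * (m - j))"
    using assms by (intro sum.mono_neutral_right) auto
  also have "real \<dots> = (\<Sum>j<m. real j * (real m - real j))"
    by (simp add: of_nat_diff)
  finally show ?thesis
    using sum_mult_diff_real[of "real m" m]
    by (simp add: algebra_simps power3_eq_cube power2_eq_square)
qed

lemma choose_two_mult: "2 * (Suc n choose 2) = Suc n * n"
  using Suc_times_binomial_eq[of n 1] by (simp add: numeral_2_eq_2)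

lemma choose_three_mult: "6 * ((n + 2) choose 3) = (n + 2) * (n + 1) * n"
proof -
  have "3 * (Suc (Suc n) choose 3) = Suc (Suc n) * (Suc n choose 2)"
    using Suc_times_binomial_eq[of "Suc n" 2] by (simp add: eval_nat_numeral)
  then have "6 * (Suc (Suc n) choose 3) = Suc (Suc n) * (2 * (Suc n choose 2))"
    by simp
  then show ?thesis by (simp only: choose_two_mult) (simp add: algebra_simps)
qed

lemma real_choose_three: "6 * real ((n + 2) choose 3) = (real n + 2) * (real n + 1) * real n"
  using arg_cong[OF choose_three_mult[of n], of real] by (simp add: algebra_simps)

lemma choose_three_eq_sum: "(n + 2) choose 3 = (\<Sum>j<Suc n. j * (Suc n - j))"
proof -
  have "6 * real ((n + 2) choose 3) = 6 * real (\<Sum>j<Suc n. j * (Suc n - j))"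
    unfolding real_choose_three sum_mult_diff[OF order_refl]
    by (simp add: algebra_simps power3_eq_cube)
  then show ?thesis by linarith
qed

text \<open>The number of colours spent, in a set that is nearly complete to a clique \<open>Q\<close>, on the
  vertices missing one given vertex of \<open>Q\<close>; the parameter \<open>p\<close> measures the room left for
  cliques outside \<open>Q\<close>. Its leading term \<open>p\<^sup>2/2\<close> is what the argument needs; the linear term
  is generous, so that \<open>layer_bound_step\<close> holds for all \<open>r\<close>.\<close>

definition layer_bound :: "nat \<Rightarrow> nat" where
  "layer_bound p = (Suc p choose 2) + 4 * p"

lemma layer_bound_double: "2 * layer_bound p = p * p + 9 * p"
  using choose_two_mult[of p] by (simp add: layer_bound_def)

lemma layer_bound_step:
  assumes "2 \<le> r" "r \<le> p"
  shows "(\<Sum>s<r. min r (p + 1 - s)) + layer_bound (p + 1 - r) \<le> layer_bound p"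
proof -
  obtain d where d: "r = d + 1" "d \<ge> 1" using assms(1) by (cases r) auto
  obtain q where q: "p = d + 1 + q" using assms(2) d by (metis le_Suc_ex)
  have tb: "2 * layer_bound p = 2 * layer_bound (p + 1 - r) + 2 * d * q + d * d + 11 * d"
    unfolding layer_bound_double using q d by (simp add: algebra_simps)
  show ?thesis
  proof (cases "d \<le> 2 * q + 5")
    \<comment> \<open>For small \<open>r\<close> each minimum is bounded by \<open>r\<close>, for large \<open>r\<close> by \<open>p + 1 - s\<close>.\<close>
    case True
    have "(\<Sum>s<r. min r (p + 1 - s)) \<le> (\<Sum>s<r. r)" by (intro sum_mono) simp
    then have "2 * (\<Sum>s<r. min r (p + 1 - s)) \<le> 2 * ((d + 1) * (d + 1))"
      using d by simp
    moreover have "d * d \<le> d * (2 * q + 5)" using True by (intro mult_left_mono) auto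
    then have "2 * ((d + 1) * (d + 1)) \<le> 2 * d * q + d * d + 11 * d"
      using d(2) by (simp add: algebra_simps)
    ultimately show ?thesis using tb by linarith
  next
    case False
    have *: "2 * (\<Sum>s<n. m + n - s) = n * (n + 2 * m + 1)" for m n :: nat
    proof (induction n arbitrary: m)
      case (Suc n)
      show ?case using Suc.IH[of "Suc m"] by (simp add: algebra_simps)
    qed simp
    have "(\<Sum>s<r. min r (p + 1 - s)) \<le> (\<Sum>s<r. q + 1 + r - s)"
      using q d by (intro sum_mono) simp
    then have "2 * (\<Sum>s<r. min r (p + 1 - s)) \<le> r * (r + 2 * (q + 1) + 1)"
      using *[of "q + 1" r] by linarith
    also have "\<dots> = (d + 1) * (d + 2 * q + 4)" using d(1) by (simp add: algebra_simps)
    also have "\<dots> \<le> 2 * d * q + d * d + 11 * d"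
      using False by (simp add: algebra_simps)
    finally show ?thesis using tb by linarith
  qed
qed

lemma choose_three_step:
  assumes "r \<le> p" "1 \<le> r"
  shows "((r + 2) choose 3) + ((p + 1 - r + 2) choose 3)
    \<le> ((p + 2) choose 3) + layer_bound (p + 1 - r)"
proof -
  obtain e where e: "p = r + e" using assms(1) le_Suc_ex by blast
  have "6 * ((r + 2) choose 3) + 6 * ((e + 1 + 2) choose 3)
      \<le> 6 * ((r + e + 2) choose 3) + 3 * (2 * layer_bound (e + 1))"
    unfolding choose_three_mult layer_bound_double by (simp add: algebra_simps)
  then show ?thesis using e by simp
qed

section \<open>Sorting the vertices by a maximum clique\<close>

context simple_adjacency
begin

text \<open>A maximum clique \<open>v 0, \<dots>, v (k - 1)\<close> sorts all vertices. The vertices missing only \<open>v j\<close>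
  (among them \<open>v j\<close> itself) form the independent set \<open>W j\<close>; those whose first two missed vertices
  are \<open>v i\<close> and \<open>v j\<close> form \<open>C i j\<close>. As \<open>C i j\<close> is complete to the other \<open>j - 1\<close> vertices
  preceding \<open>v j\<close>, its cliques have at most \<open>k + 1 - j\<close> vertices.\<close>

lemma clique_cover:
  assumes "finite S" and k: "cliques_le S k"
    and A: "A \<subseteq> S" "is_clique A" "card A = k"
  obtains v :: "nat \<Rightarrow> 'a" and W :: "nat \<Rightarrow> 'a set" and C :: "nat \<Rightarrow> nat \<Rightarrow> 'a set"
  where "S = (\<Union>j<k. W j) \<union> (\<Union>j<k. \<Union>i<j. C i j)"
    and "\<And>j. j < k \<Longrightarrow> colourable (W j) 1"
    and "\<And>i j. i < j \<Longrightarrow> j < k \<Longrightarrow> E (v i) (v j)"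
    and "\<And>i j. i < j \<Longrightarrow> j < k \<Longrightarrow> C i j \<subseteq> {x \<in> S. \<not> E x (v i) \<and> \<not> E x (v j)}"
    and "\<And>i j. i < j \<Longrightarrow> j < k \<Longrightarrow> cliques_le (C i j) (k + 1 - j)"
proof -
  have finA: "finite A" using A assms(1) finite_subset by blast
  obtain v :: "nat \<Rightarrow> 'a" where v: "bij_betw v {..<k} A"
    using ex_bij_betw_nat_finite[OF finA] A(3) by (auto simp: atLeast0LessThan)
  have inj: "v i = v j \<longleftrightarrow> i = j" if "i < k" "j < k" for i j
    using bij_betw_imp_inj_on[OF v] that by (auto simp: inj_on_eq_iff)
  have vA: "v i \<in> A" if "i < k" for i using v that by (auto simp: bij_betw_def)
  have vE: "E (v i) (v j)" if "i < k" "j < k" "i \<noteq> j" for i j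
    using A(2) vA[OF that(1)] vA[OF that(2)] inj[OF that(1,2)] that(3)
    by (simp add: is_clique_def)
  have extend: "card K + card L \<le> k"
    if K: "K \<subseteq> S" "is_clique K" and L: "L \<subseteq> {..<k}"
      and KL: "\<And>x l. x \<in> K \<Longrightarrow> l \<in> L \<Longrightarrow> E x (v l)" for K L
  proof -
    have "is_clique (v ` L)" using vA L by (intro is_clique_subset[OF A(2)]) auto
    then have "is_clique (K \<union> v ` L)" using K KL by (intro is_clique_Un) auto
    moreover have "v ` L \<subseteq> S" using vA L A(1) by blast
    then have "K \<union> v ` L \<subseteq> S" using K by simp
    moreover have "K \<inter> v ` L = {}" using KL irrefl by blast
    moreover have "card (v ` L) = card L"
      using bij_betw_imp_inj_on[OF v] L by (intro card_image) (auto intro: inj_on_subset)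
    ultimately show ?thesis
      using cliques_leD[OF k, of "K \<union> v ` L"] card_Un_disjoint[of K "v ` L"] assms(1)
      by (metis finite_Un finite_subset)
  qed
  define W where "W j = {x \<in> S. \<not> E x (v j) \<and> (\<forall>l<k. l \<noteq> j \<longrightarrow> E x (v l))}" for j
  define C where "C i j = {x \<in> S. \<not> E x (v i) \<and> \<not> E x (v j) \<and>
      (\<forall>l<j. l \<noteq> i \<longrightarrow> E x (v l))}" for i j
  show thesis
  proof (rule that[of W C v])
    have "x \<in> (\<Union>j<k. W j) \<union> (\<Union>j<k. \<Union>i<j. C i j)" if x: "x \<in> S" for x
    proof -
      define M where "M = {l. l < k \<and> \<not> E x (v l)}"
      have "M \<noteq> {}"
      proof
        assume "M = {}"
        then have "card {x} + card {..<k} \<le> k"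
          using x by (intro extend) (auto simp: M_def is_clique_def)
        then show False by simp
      qed
      define i where "i = Inf M"
      have i: "i \<in> M" "\<And>l. l \<in> M \<Longrightarrow> i \<le> l"
        using Inf_nat_def1[OF \<open>M \<noteq> {}\<close>] wellorder_Inf_le1 unfolding i_def by auto
      show ?thesis
      proof (cases "M = {i}")
        case True
        then have "x \<in> W i" using x i(1) by (auto simp: W_def M_def)
        then show ?thesis using i(1) by (auto simp: M_def)
      next
        case False
        define j where "j = Inf (M - {i})"
        have ne: "M - {i} \<noteq> {}" using False i(1) by blast
        have j: "j \<in> M - {i}" "\<And>l. l \<in> M - {i} \<Longrightarrow> j \<le> l"
          unfolding j_def by (fact Inf_nat_def1[OF ne], fact wellorder_Inf_le1)
        have "i < j" using i(2)[of j] j(1) by auto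
        moreover have "E x (v l)" if "l < j" "l \<noteq> i" for l
          using j(2)[of l] j(1) that by (auto simp: M_def)
        then have "x \<in> C i j" using x i(1) j(1) by (auto simp: C_def M_def)
        ultimately show ?thesis using j(1) by (auto simp: M_def)
      qed
    qed
    then have "S \<subseteq> (\<Union>j<k. W j) \<union> (\<Union>j<k. \<Union>i<j. C i j)" by (rule subsetI)
    moreover have "(\<Union>j<k. W j) \<union> (\<Union>j<k. \<Union>i<j. C i j) \<subseteq> S" by (auto simp: W_def C_def)
    ultimately show "S = (\<Union>j<k. W j) \<union> (\<Union>j<k. \<Union>i<j. C i j)" by (rule equalityI)
  next
    fix j assume j: "j < k"
    show "colourable (W j) 1"
    proof (rule independent_colourable)
      fix x y assume xy: "x \<in> W j" "y \<in> W j"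
      show "\<not> E x y"
      proof
        assume "E x y"
        then have "x \<noteq> y" using irrefl by blast
        have "card {x, y} + card ({..<k} - {j}) \<le> k"
          using xy \<open>E x y\<close> sym by (intro extend) (auto simp: W_def is_clique_def)
        then show False using \<open>x \<noteq> y\<close> j by simp
      qed
    qed
  next
    fix i j assume ij: "i < j" "j < k"
    show "E (v i) (v j)" using vE ij by simp
    show "C i j \<subseteq> {x \<in> S. \<not> E x (v i) \<and> \<not> E x (v j)}" by (auto simp: C_def)
    show "cliques_le (C i j) (k + 1 - j)"
      unfolding cliques_le_def
    proof (intro allI impI)
      fix K assume K: "K \<subseteq> C i j" "is_clique K"
      have "card K + card ({..<j} - {i}) \<le> k"
        using K ij by (intro extend) (auto simp: C_def)
      then show "card K \<le> k + 1 - j" using ij by simp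
    qed
  qed
qed

end

text \<open>Freeness of \<open>P\<^sub>2 \<union> P\<^sub>3\<close>: the common non-neighbours of the two ends of an edge induce no
  \<open>P\<^sub>3\<close>. The ends themselves are not among these non-neighbours, being adjacent to each other.\<close>

locale P2_P3_free_adjacency = simple_adjacency +
  assumes common_nonneighbours_P3_free: "E a b \<Longrightarrow> P3_free {x. \<not> E x a \<and> \<not> E x b}"
begin

lemma P3_free_subset: "P3_free S \<Longrightarrow> T \<subseteq> S \<Longrightarrow> P3_free T"
  unfolding P3_free_def by blast

lemma nonneighbours_colourable:
  assumes "finite S" "E a b" "S \<subseteq> {x. \<not> E x a \<and> \<not> E x b}" "cliques_le S n"
  shows "colourable S n"
  using assms common_nonneighbours_P3_free P3_free_subset by (intro P3_free_colourable) blast+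

text \<open>Each class \<open>C i j\<close> of the cover lies in the common non-neighbourhood of an edge, so it can be
  coloured with \<open>k + 1 - j\<close> colours. This bound is used inside the next construction, where only
  subsets with smaller cliques have to be coloured.\<close>

lemma colourable_choose_three:
  assumes "finite S" "cliques_le S n"
  shows "colourable S ((n + 2) choose 3)"
proof -
  obtain A where A: "A \<subseteq> S" "is_clique A" "cliques_le S (card A)"
    using obtain_max_clique[OF assms(1)] by blast
  define k where "k = card A"
  have "k \<le> n" using cliques_leD[OF assms(2)] A unfolding k_def by blast
  obtain v W C where
    S: "S = (\<Union>j<k. W j) \<union> (\<Union>j<k. \<Union>i<j. C i j)" and
    W: "\<And>j. j < k \<Longrightarrow> colourable (W j) 1" and
    v: "\<And>i j. i < j \<Longrightarrow> j < k \<Longrightarrow> E (v i) (v j)" and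
    C: "\<And>i j. i < j \<Longrightarrow> j < k \<Longrightarrow> C i j \<subseteq> {x \<in> S. \<not> E x (v i) \<and> \<not> E x (v j)}" and
    Cle: "\<And>i j. i < j \<Longrightarrow> j < k \<Longrightarrow> cliques_le (C i j) (k + 1 - j)"
    by (rule clique_cover[OF assms(1) A(3) A(1,2) refl, folded k_def]) (rule that)
  have "colourable (C i j) (k + 1 - j)" if "i < j" "j < k" for i j
  proof (rule nonneighbours_colourable[OF _ v[OF that]])
    show "finite (C i j)" using C[OF that] assms(1) by (auto intro: finite_subset)
  qed (use C[OF that] Cle[OF that] in auto)
  then have "colourable S ((\<Sum>j<k. 1) + (\<Sum>j<k. \<Sum>i<j. k + 1 - j))"
    unfolding S using W by (intro colourable_Un colourable_UN) auto
  moreover have "(\<Sum>j<k. 1) + (\<Sum>j<k. \<Sum>i<j. k + 1 - j) = (k + 2) choose 3"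
    unfolding choose_three_eq_sum by simp
  ultimately have "colourable S ((k + 2) choose 3)" by (simp only:)
  then show ?thesis using \<open>k \<le> n\<close> by (elim colourable_mono) (auto intro: binomial_right_mono)
qed

end

section \<open>Vertex sets nearly complete to a clique\<close>

context P2_P3_free_adjacency
begin

text \<open>Here every vertex of \<open>X\<close> misses at most one vertex of the clique \<open>Q\<close>, of size \<open>n + 1\<close>. Let
  \<open>Z a\<close> consist of the vertices of \<open>X\<close> that miss no vertex of \<open>Q\<close> except possibly \<open>a\<close>. One
  set \<open>Z a\<close>, containing a largest clique \<open>R\<close> found in any of them, is coloured by the cubic
  bound. A vertex outside it misses some \<open>c \<noteq> a\<close>, and \<open>R\<close> is complete to \<open>c\<close>: the vertices
  missing \<open>c\<close> whose first missed vertex in \<open>R\<close> is \<open>\<rho> s\<close> are therefore anticomplete to the edge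
  joining \<open>\<rho> s\<close> and \<open>c\<close>, and their cliques are small because they extend by the earlier vertices
  of \<open>R\<close> and by all of \<open>Q\<close> but \<open>a\<close> and \<open>c\<close>. What remains is complete to \<open>R\<close> and nearly complete to
  \<open>Q - {a}\<close>, so that induction applies with \<open>p + 1 - r\<close> in place of \<open>p\<close>.\<close>

lemma near_complete_colourable:
  assumes "finite X" "finite Q" "is_clique Q" "card Q = Suc n" "X \<inter> Q = {}"
    and "\<And>x a b. x \<in> X \<Longrightarrow> a \<in> Q \<Longrightarrow> b \<in> Q \<Longrightarrow> a \<noteq> b \<Longrightarrow> E x a \<or> E x b"
    and "cliques_le (X \<union> Q) (n + p)"
  shows "colourable X (((p + 2) choose 3) + n * layer_bound p)"
  using assms
proof (induction n arbitrary: X Q p)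
  case 0
  have "cliques_le X p" using 0(7) by (auto elim: cliques_le_mono)
  then show ?case using colourable_choose_three[OF 0(1)] by simp
next
  case (Suc n)
  note finX = Suc.prems(1) and finQ = Suc.prems(2) and Q = Suc.prems(3) and card = Suc.prems(4)
    and disj = Suc.prems(5) and near = Suc.prems(6) and le = Suc.prems(7)
  define Z where "Z a = {x \<in> X. \<forall>b\<in>Q - {a}. E x b}" for a
  have ZX: "Z a \<subseteq> X" for a by (auto simp: Z_def)
  have finZ: "finite (Z a)" for a using finX ZX finite_subset by blast
  have "Q \<noteq> {}" using card by auto
  have cover: "\<exists>c\<in>Q. x \<in> Z c \<and> (\<forall>b\<in>Q. \<not> E x b \<longrightarrow> b = c)" if "x \<in> X" for x
    using near[OF that] that \<open>Q \<noteq> {}\<close> unfolding Z_def by (cases "\<forall>b\<in>Q. E x b") blast+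
  obtain a R where a: "a \<in> Q" and R: "R \<subseteq> Z a" "is_clique R"
    and max: "\<And>c. c \<in> Q \<Longrightarrow> cliques_le (Z c) (card R)"
  proof -
    have "\<exists>K. K \<subseteq> Z c \<and> is_clique K \<and> cliques_le (Z c) (card K)" for c
      using obtain_max_clique[OF finZ[of c]] by metis
    then obtain f where f: "\<And>c. f c \<subseteq> Z c" "\<And>c. is_clique (f c)"
      "\<And>c. cliques_le (Z c) (card (f c))" by metis
    have "Max ((\<lambda>c. card (f c)) ` Q) \<in> (\<lambda>c. card (f c)) ` Q"
      using finQ \<open>Q \<noteq> {}\<close> by (intro Max_in) auto
    then obtain a where a: "a \<in> Q" "card (f a) = Max ((\<lambda>c. card (f c)) ` Q)" by auto
    have "card (f c) \<le> card (f a)" if "c \<in> Q" for c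
      using finQ that a(2) by simp
    then have "cliques_le (Z c) (card (f a))" if "c \<in> Q" for c
      using cliques_le_mono[OF f(3) subset_refl] that by blast
    then show thesis by (rule that[OF a(1) f(1,2)])
  qed
  define r where "r = card R"
  have RX: "R \<subseteq> X" using R ZX by blast
  have finR: "finite R" using RX finX finite_subset by blast
  \<comment> \<open>The clique bound for a clique composed of two parts in \<open>X\<close> and one part in \<open>Q\<close>.\<close>
  have ext: "card K + card L + card M \<le> Suc n + p"
    if "K \<subseteq> X" "is_clique K" "L \<subseteq> X" "is_clique L" "M \<subseteq> Q" "K \<inter> L = {}"
      "\<And>x y. x \<in> K \<Longrightarrow> y \<in> L \<Longrightarrow> E x y" "\<And>x y. x \<in> K \<union> L \<Longrightarrow> y \<in> M \<Longrightarrow> E x y" for K L M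
  proof -
    have fin: "finite K" "finite L" "finite M"
      using that finX finQ finite_subset by blast+
    have "is_clique ((K \<union> L) \<union> M)"
      using that is_clique_subset[OF Q] by (intro is_clique_Un) auto
    then have "card ((K \<union> L) \<union> M) \<le> Suc n + p"
      using that by (intro cliques_leD[OF le]) auto
    moreover have "(K \<union> L) \<inter> M = {}" using that disj by blast
    ultimately show ?thesis using fin that by (simp add: card_Un_disjoint)
  qed
  have "card R + card (Q - {a}) \<le> Suc n + p"
    using ext[of "{}" R "Q - {a}"] R RX by (auto simp: Z_def is_clique_def)
  then have rp: "r \<le> p" using card a finQ by (simp add: r_def)
  have "card Q \<le> Suc n + p"
    using ext[of "{}" "{}" Q] by (simp add: is_clique_def)
  then have p1: "1 \<le> p" using card by simp
  show ?case
  proof (cases "r \<le> 1")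
    \<comment> \<open>Then \<open>p\<close> would not decrease, but all sets \<open>Z c\<close> are independent.\<close>
    case True
    have "colourable (Z c) 1" if "c \<in> Q" for c
    proof (rule independent_colourable)
      have "cliques_le (Z c) 1" using max[OF that] True by (auto elim: cliques_le_mono simp: r_def)
      then show "\<And>x y. x \<in> Z c \<Longrightarrow> y \<in> Z c \<Longrightarrow> \<not> E x y"
        by (rule cliques_le_1_independent)
    qed
    then have "colourable (\<Union>c\<in>Q. Z c) (\<Sum>c\<in>Q. 1)" using finQ by (intro colourable_UN)
    moreover have "X \<subseteq> (\<Union>c\<in>Q. Z c)" using cover by blast
    moreover have "(\<Sum>c\<in>Q. 1) \<le> ((p + 2) choose 3) + Suc n * layer_bound p"
    proof -
      have "1 \<le> (p + 2) choose 3" using p1 by (simp add: Suc_le_eq)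
      moreover have "1 \<le> layer_bound p" using p1 by (simp add: layer_bound_def)
      then have "Suc n * 1 \<le> Suc n * layer_bound p" by (rule mult_left_mono) simp
      ultimately show ?thesis using card by simp
    qed
    ultimately show ?thesis by (rule colourable_mono)
  next
    case False
    obtain \<rho> :: "nat \<Rightarrow> 'a" where \<rho>: "bij_betw \<rho> {..<r} R"
      using ex_bij_betw_nat_finite[OF finR] by (auto simp: atLeast0LessThan r_def)
    have \<rho>R: "\<rho> t \<in> R" if "t < r" for t using \<rho> that by (auto simp: bij_betw_def)
    define D where "D c s = {x \<in> Z c. \<not> E x c \<and> \<not> E x (\<rho> s) \<and> (\<forall>t<s. E x (\<rho> t))}" for c s
    define X' where "X' = {x \<in> X - Z a. \<forall>t<r. E x (\<rho> t)}"
    have ED: "E (\<rho> t) c" if "t < r" "c \<in> Q - {a}" for t c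
      using \<rho>R[OF that(1)] R(1) that(2) by (auto simp: Z_def)
    have "colourable (D c s) (min r (p + 1 - s))" if c: "c \<in> Q - {a}" and s: "s < r" for c s
    proof (rule nonneighbours_colourable[OF _ ED[OF s c]])
      have DZ: "D c s \<subseteq> Z c" by (auto simp: D_def)
      show "finite (D c s)" using DZ finZ finite_subset by blast
      show "D c s \<subseteq> {x. \<not> E x (\<rho> s) \<and> \<not> E x c}" by (auto simp: D_def)
      show "cliques_le (D c s) (min r (p + 1 - s))"
        unfolding cliques_le_def
      proof (intro allI impI)
        fix K assume K: "K \<subseteq> D c s" "is_clique K"
        have 1: "card K \<le> r"
          using cliques_leD[OF max, of c K] K DZ c by (auto simp: r_def)
        have "card (\<rho> ` {..<s}) = s"
          using bij_betw_imp_inj_on[OF \<rho>] s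
          by (subst card_image) (auto intro: inj_on_subset)
        moreover have "card {a, c} = 2" using c by auto
        then have "card (Q - {a, c}) = n"
          using c a card finQ by (simp add: card_Diff_subset)
        moreover have sub: "\<rho> ` {..<s} \<subseteq> R" using \<rho>R s by auto
        have "card K + card (\<rho> ` {..<s}) + card (Q - {a, c}) \<le> Suc n + p"
        proof (rule ext)
          show "K \<subseteq> X" "is_clique K" using K DZ ZX by blast+
          show "\<rho> ` {..<s} \<subseteq> X" "is_clique (\<rho> ` {..<s})" "Q - {a, c} \<subseteq> Q"
            using sub RX is_clique_subset[OF R(2) sub] by auto
          show KE: "\<And>x y. x \<in> K \<Longrightarrow> y \<in> \<rho> ` {..<s} \<Longrightarrow> E x y" using K(1) by (auto simp: D_def)
          then show "K \<inter> \<rho> ` {..<s} = {}" using irrefl by blast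
          show "\<And>x y. x \<in> K \<union> \<rho> ` {..<s} \<Longrightarrow> y \<in> Q - {a, c} \<Longrightarrow> E x y"
            using K(1) sub R(1) by (auto simp: D_def Z_def)
        qed
        ultimately show "card K \<le> min r (p + 1 - s)" using 1 by simp
      qed
    qed
    then have 1: "colourable (\<Union>c\<in>Q - {a}. \<Union>s<r. D c s)
        (\<Sum>c\<in>Q - {a}. \<Sum>s<r. min r (p + 1 - s))"
      using finQ by (intro colourable_UN) auto
    have 2: "colourable (Z a) ((r + 2) choose 3)"
      using max[OF a] by (intro colourable_choose_three finZ) (simp add: r_def)
    have 3: "colourable X' (((p + 1 - r + 2) choose 3) + n * layer_bound (p + 1 - r))"
    proof (rule Suc.IH)
      show "finite X'" using finX by (auto simp: X'_def)
      show "finite (Q - {a})" using finQ by simp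
      show "is_clique (Q - {a})" by (rule is_clique_subset[OF Q]) auto
      show "card (Q - {a}) = Suc n" using card a finQ by simp
      show "X' \<inter> (Q - {a}) = {}" using disj by (auto simp: X'_def)
      show "\<And>x b c. x \<in> X' \<Longrightarrow> b \<in> Q - {a} \<Longrightarrow> c \<in> Q - {a} \<Longrightarrow> b \<noteq> c \<Longrightarrow> E x b \<or> E x c"
        using near by (auto simp: X'_def)
      show "cliques_le (X' \<union> (Q - {a})) (n + (p + 1 - r))"
        unfolding cliques_le_def
      proof (intro allI impI)
        fix K assume K: "K \<subseteq> X' \<union> (Q - {a})" "is_clique K"
        have KE: "E x y" if "x \<in> K" "y \<in> R" for x y
        proof (cases "x \<in> X'")
          case True
          obtain t where "t < r" "y = \<rho> t" using \<rho> \<open>y \<in> R\<close> by (auto simp: bij_betw_def)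
          then show ?thesis using True by (simp add: X'_def)
        next
          case False
          then have "x \<in> Q - {a}" using K(1) that(1) by blast
          then show ?thesis using that(2) R(1) sym by (auto simp: Z_def)
        qed
        have "is_clique (K \<union> R)" using K(2) R(2) KE by (rule is_clique_Un)
        moreover have "K \<union> R \<subseteq> X \<union> Q" using K(1) RX by (auto simp: X'_def)
        ultimately have "card (K \<union> R) \<le> Suc n + p" using cliques_leD[OF le] by blast
        moreover have "K \<inter> R = {}" using KE irrefl by blast
        moreover have "finite K" using K(1) finX finQ by (auto simp: X'_def intro: finite_subset)
        ultimately have "card K + r \<le> Suc n + p" using finR by (simp add: card_Un_disjoint r_def)
        then show "card K \<le> n + (p + 1 - r)" using rp by simp
      qed
    qed
    have "X \<subseteq> Z a \<union> (\<Union>c\<in>Q - {a}. \<Union>s<r. D c s) \<union> X'"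
    proof
      fix x assume x: "x \<in> X"
      show "x \<in> Z a \<union> (\<Union>c\<in>Q - {a}. \<Union>s<r. D c s) \<union> X'"
      proof (cases "x \<in> Z a \<or> x \<in> X'")
        case False
        obtain c where c: "c \<in> Q" "x \<in> Z c" "\<And>b. b \<in> Q \<Longrightarrow> \<not> E x b \<Longrightarrow> b = c"
          using cover[OF x] by blast
        have "c \<noteq> a" using c False by blast
        obtain b where b: "b \<in> Q - {a}" "\<not> E x b" using False x by (auto simp: Z_def)
        then have "\<not> E x c" using c(3) by auto
        obtain t where t: "t < r" "\<not> E x (\<rho> t)" using False x by (auto simp: X'_def)
        let ?P = "\<lambda>t. \<not> E x (\<rho> t)"
        define s where "s = (LEAST t. ?P t)"
        have "\<not> E x (\<rho> s)" unfolding s_def by (rule LeastI[of ?P]) (rule t(2))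
        moreover have "s \<le> t" unfolding s_def by (rule Least_le[of ?P]) (rule t(2))
        moreover have "E x (\<rho> u)" if "u < s" for u
          using not_less_Least[of u ?P] that unfolding s_def by simp
        ultimately have "x \<in> D c s" "s < r" using c(2) \<open>\<not> E x c\<close> t(1) by (auto simp: D_def)
        then show ?thesis using c(1) \<open>c \<noteq> a\<close> by blast
      qed auto
    qed
    moreover have "((r + 2) choose 3) + (\<Sum>c\<in>Q - {a}. \<Sum>s<r. min r (p + 1 - s)) +
        (((p + 1 - r + 2) choose 3) + n * layer_bound (p + 1 - r))
      \<le> ((p + 2) choose 3) + Suc n * layer_bound p" (is "?l \<le> ?r")
    proof -
      let ?c = "\<Sum>s<r. min r (p + 1 - s)" and ?h = "layer_bound (p + 1 - r)"
      have "Suc n * (?c + ?h) \<le> Suc n * layer_bound p"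
        using layer_bound_step[of r p] False rp by (intro mult_left_mono) auto
      moreover have "((r + 2) choose 3) + ((p + 1 - r + 2) choose 3) \<le> ((p + 2) choose 3) + ?h"
        using choose_three_step[of r p] False rp by simp
      moreover have "(\<Sum>c\<in>Q - {a}. ?c) = Suc n * ?c" using card a finQ by simp
      ultimately show ?thesis by (simp add: algebra_simps)
    qed
    ultimately show ?thesis
      using colourable_Un[OF colourable_Un[OF 2 1] 3] by (auto elim: colourable_mono)
  qed
qed

end

section \<open>Two edges anticomplete to a clique\<close>

context P2_P3_free_adjacency
begin

text \<open>The configuration on which the argument divides: edges \<open>i j\<close> and \<open>c d\<close> and a clique \<open>Q\<close>
  of \<open>b\<close> vertices, with no edge between any two of the three. Only \<open>Q\<close> is required to lie in
  \<open>S\<close>.\<close>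

definition anticomplete_edges_and_clique :: "'a set \<Rightarrow> nat \<Rightarrow> bool" where
  "anticomplete_edges_and_clique S b \<longleftrightarrow> (\<exists>i j c d Q. E i j \<and> E c d \<and>
     Q \<subseteq> S \<and> is_clique Q \<and> card Q = b \<and>
     (\<forall>x\<in>Q. \<not> E x i \<and> \<not> E x j) \<and> (\<forall>x\<in>Q. \<not> E x c \<and> \<not> E x d) \<and>
     \<not> E c i \<and> \<not> E c j \<and> \<not> E d i \<and> \<not> E d j)"

text \<open>If the configuration is present, let \<open>X\<close> be the set of vertices outside \<open>Q\<close> that miss at
  most one vertex of \<open>Q\<close>. Any other vertex \<open>y\<close> outside \<open>Q\<close> misses an edge \<open>e f\<close> of \<open>Q\<close>. If
  \<open>y\<close> had a neighbour \<open>a\<close> in \<open>Q\<close>, then, since the path \<open>y a e\<close> is induced and \<open>Q\<close> is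
  anticomplete to the edges \<open>i j\<close> and \<open>c d\<close>, the vertex \<open>y\<close> would be
  adjacent to an end \<open>u\<close> of \<open>i j\<close> and to an end \<open>w\<close> of \<open>c d\<close>; but \<open>u y w\<close> together with
  \<open>e f\<close> is an induced \<open>P\<^sub>2 \<union> P\<^sub>3\<close>. So everything outside \<open>X\<close> and \<open>Q\<close> is anticomplete to
  \<open>Q\<close>, and the complement of \<open>X\<close> contains no induced \<open>P\<^sub>3\<close>.\<close>

lemma colourable_if_anticomplete_edges_and_clique:
  assumes fin: "finite S" and k: "cliques_le S k" and b2: "2 \<le> b"
    and "anticomplete_edges_and_clique S b"
  shows "colourable S (k + (((k + 1 - b + 2) choose 3) + (b - 1) * layer_bound (k + 1 - b)))"
proof -
  obtain i j c d Q where ij: "E i j" and cd: "E c d"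
    and Q: "Q \<subseteq> S" "is_clique Q" "card Q = b"
    and Qij: "\<And>x. x \<in> Q \<Longrightarrow> \<not> E x i \<and> \<not> E x j"
    and Qcd: "\<And>x. x \<in> Q \<Longrightarrow> \<not> E x c \<and> \<not> E x d"
    and cdij: "\<not> E c i" "\<not> E c j" "\<not> E d i" "\<not> E d j"
    using assms(4) unfolding anticomplete_edges_and_clique_def by auto
  define X where "X = {x \<in> S - Q. \<forall>a\<in>Q. \<forall>a'\<in>Q. a \<noteq> a' \<longrightarrow> E x a \<or> E x a'}"
  have finQ: "finite Q" using Q fin finite_subset by blast
  have bk: "b \<le> k" using cliques_leD[OF k Q(1,2)] Q(3) by simp
  have anti: "\<not> E y a" if y: "y \<in> S - X - Q" and a: "a \<in> Q" for y a
  proof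
    assume "E y a"
    obtain e f where ef: "e \<in> Q" "f \<in> Q" "e \<noteq> f" "\<not> E y e" "\<not> E y f"
      using y unfolding X_def by blast
    have "E e f" using Q(2) ef unfolding is_clique_def by blast
    have "a \<noteq> e" using \<open>E y a\<close> ef(4) by blast
    then have "E a e" using Q(2) a ef(1) unfolding is_clique_def by blast
    have hit: "E y u \<or> E y w" if "E u w" "\<And>x. x \<in> Q \<Longrightarrow> \<not> E x u \<and> \<not> E x w" for u w
    proof (rule ccontr)
      assume "\<not> (E y u \<or> E y w)"
      then have "{y, a, e} \<subseteq> {x. \<not> E x u \<and> \<not> E x w}" using that(2) a ef(1) by blast
      then have "P3_free {y, a, e}"
        using common_nonneighbours_P3_free[OF that(1)] P3_free_subset by blast
      moreover have "y \<noteq> e" using y ef(1) by blast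
      ultimately show False using \<open>E y a\<close> \<open>E a e\<close> ef(4) unfolding P3_free_def by blast
    qed
    obtain u where u: "E y u" "u = i \<or> u = j" using hit[OF ij Qij] by blast
    obtain w where w: "E y w" "w = c \<or> w = d" using hit[OF cd Qcd] by blast
    have "{u, y, w} \<subseteq> {x. \<not> E x e \<and> \<not> E x f}"
      using u(2) w(2) ef Qij Qcd sym by blast
    then have "P3_free {u, y, w}"
      using common_nonneighbours_P3_free[OF \<open>E e f\<close>] P3_free_subset by blast
    moreover have "\<not> E u w" using u(2) w(2) cdij sym by blast
    moreover have "u \<noteq> w" using u(2) w(2) cdij ij sym by blast
    ultimately show False using u(1) w(1) sym[OF u(1)] unfolding P3_free_def by blast
  qed
  obtain e f where ef: "e \<in> Q" "f \<in> Q" "e \<noteq> f"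
    using card_le_Suc0_iff_eq[OF finQ] Q(3) b2 by auto
  have "E e f" using Q(2) ef unfolding is_clique_def by blast
  have "S - X - Q \<subseteq> {x. \<not> E x e \<and> \<not> E x f}" using anti ef by blast
  then have P3: "P3_free (S - X - Q)"
    using common_nonneighbours_P3_free[OF \<open>E e f\<close>] P3_free_subset by blast
  have "P3_free (S - X)"
    unfolding P3_free_def
  proof (intro ballI impI)
    fix x y z assume xyz: "x \<in> S - X" "y \<in> S - X" "z \<in> S - X" "E x y" "E y z" "x \<noteq> z"
    have step: "u \<in> Q \<longleftrightarrow> w \<in> Q" if "u \<in> S - X" "w \<in> S - X" "E u w" for u w
      using anti[of u w] anti[of w u] that sym by blast
    have "x \<in> Q \<longleftrightarrow> y \<in> Q" "y \<in> Q \<longleftrightarrow> z \<in> Q" using step xyz by simp_all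
    then show "E x z" using P3 Q(2) xyz unfolding P3_free_def is_clique_def by blast
  qed
  then have "colourable (S - X) k"
    using fin k by (intro P3_free_colourable) (auto elim: cliques_le_mono)
  moreover have "colourable X (((k + 1 - b + 2) choose 3) + (b - 1) * layer_bound (k + 1 - b))"
  proof (rule near_complete_colourable[OF _ finQ Q(2)])
    show "cliques_le (X \<union> Q) (b - 1 + (k + 1 - b))"
      using k Q(1) b2 bk by (auto elim: cliques_le_mono simp: X_def)
  qed (use fin Q b2 in \<open>auto simp: X_def\<close>)
  ultimately have "colourable ((S - X) \<union> X)
      (k + (((k + 1 - b + 2) choose 3) + (b - 1) * layer_bound (k + 1 - b)))"
    by (rule colourable_Un)
  then show ?thesis by (rule colourable_mono) auto
qed

text \<open>If the configuration is absent, a class \<open>C i j\<close> of the cover that contains a clique of \<open>b\<close>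
  vertices has no edge outside its largest clique. All these large cliques together form a set
  \<open>B\<close>, which is coloured by pairing non-adjacent vertices: this halves their cost. The
  remaining classes need fewer than \<open>b\<close> colours each. In the sum below, \<open>2 min (k + 1 - j) b\<close>
  is twice the cost of a class with small cliques, and the truncated difference
  \<open>k + 3 - 2 b - j\<close> is twice the surplus when half of a large clique, with one colour for the rest
  of its class, costs more than \<open>b\<close>.\<close>

lemma colourable_if_no_anticomplete_edges_and_clique:
  assumes fin: "finite S" and k: "cliques_le S k" and A: "A \<subseteq> S" "is_clique A" "card A = k"
    and none: "\<not> anticomplete_edges_and_clique S b"
  obtains N where "colourable S N"
    and "2 * N \<le> 3 * k + (\<Sum>j<k. j * (2 * min (k + 1 - j) b + (k + 3 - 2 * b - j)))"
proof -
  obtain v W C where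
    S: "S = (\<Union>j<k. W j) \<union> (\<Union>j<k. \<Union>i<j. C i j)" and
    W: "\<And>j. j < k \<Longrightarrow> colourable (W j) 1" and
    v: "\<And>i j. i < j \<Longrightarrow> j < k \<Longrightarrow> E (v i) (v j)" and
    C: "\<And>i j. i < j \<Longrightarrow> j < k \<Longrightarrow> C i j \<subseteq> {x \<in> S. \<not> E x (v i) \<and> \<not> E x (v j)}" and
    Cle: "\<And>i j. i < j \<Longrightarrow> j < k \<Longrightarrow> cliques_le (C i j) (k + 1 - j)"
    by (rule clique_cover[OF fin k A]) (rule that)
  define u where "u j = k + 1 - j" for j
  \<comment> \<open>\<open>K\<close> is the large clique of the class, or empty if all its cliques have fewer than \<open>b\<close>
    vertices; \<open>m\<close> is the number of colours for the rest.\<close>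
  have "\<exists>K m. K \<subseteq> C i j \<and> colourable (C i j - K) m \<and>
      card K + 2 * m \<le> 2 * min (u j) b + (u j + 2 - 2 * b)" if ij: "i < j" "j < k" for i j
  proof -
    define D where "D = C i j"
    have D: "D \<subseteq> {x \<in> S. \<not> E x (v i) \<and> \<not> E x (v j)}" unfolding D_def by (rule C[OF ij])
    have finC: "finite D" using finite_subset[OF D] fin by simp
    obtain K where K: "K \<subseteq> D" "is_clique K" "cliques_le D (card K)"
      using obtain_max_clique[OF finC] by blast
    have finK: "finite K" using K finC finite_subset by blast
    have Ku: "card K \<le> u j" using cliques_leD[OF Cle[OF ij]] K(1,2) by (simp add: u_def D_def)
    have P3: "P3_free D"
      using D by (intro P3_free_subset[OF common_nonneighbours_P3_free[OF v[OF ij]]]) auto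
    have "\<exists>K m. K \<subseteq> D \<and> colourable (D - K) m \<and>
        card K + 2 * m \<le> 2 * min (u j) b + (u j + 2 - 2 * b)"
    proof (cases "b \<le> card K")
      case False
      have "colourable D (card K)" using P3_free_colourable[OF finC P3 K(3)] .
      then show ?thesis using False Ku by (intro exI[of _ "{}"] exI[of _ "card K"]) auto
    next
      case True
      \<comment> \<open>\<open>K\<close> is a component of \<open>D\<close>, because \<open>D\<close> contains no induced \<open>P\<^sub>3\<close>.\<close>
      have anti: "\<not> E c x" if c: "c \<in> D - K" and x: "x \<in> K" for c x
      proof
        assume "E c x"
        then have "E c y" if "y \<in> K" for y
          using P3 c x that K(1,2) unfolding P3_free_def is_clique_def by (cases "x = y") blast+
        then have "is_clique (insert c K)"
          using K(2) sym unfolding is_clique_def by blast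
        then have "card (insert c K) \<le> card K" using cliques_leD[OF K(3)] c K(1) by blast
        then show False using c finK by simp
      qed
      obtain Q where Q: "Q \<subseteq> K" "card Q = b" using True by (meson obtain_subset_with_card_n)
      have "colourable (D - K) 1"
      proof (rule independent_colourable, rule notI)
        fix c d assume cd: "c \<in> D - K" "d \<in> D - K" "E c d"
        show False
        proof (rule notE[OF none])
          have "Q \<subseteq> S" using Q K D by blast
          moreover have "is_clique Q" by (rule is_clique_subset[OF K(2) Q(1)])
          moreover have "\<forall>x\<in>Q. \<not> E x (v i) \<and> \<not> E x (v j)" using Q K D by blast
          moreover have "\<forall>x\<in>Q. \<not> E x c \<and> \<not> E x d" using anti cd(1,2) Q(1) sym by blast
          moreover have "\<not> E c (v i)" "\<not> E c (v j)" "\<not> E d (v i)" "\<not> E d (v j)"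
            using cd D by auto
          ultimately show "anticomplete_edges_and_clique S b"
            unfolding anticomplete_edges_and_clique_def using v[OF ij] cd(3) Q(2)
            by (intro exI[of _ "v i"] exI[of _ "v j"] exI[of _ c] exI[of _ d] exI[of _ Q] conjI)
        qed
      qed
      then show ?thesis using True Ku K(1) by (intro exI[of _ K] exI[of _ 1]) auto
    qed
    then show ?thesis unfolding D_def .
  qed
  then obtain K m where
    KC: "\<And>i j. i < j \<Longrightarrow> j < k \<Longrightarrow> K i j \<subseteq> C i j" and
    m: "\<And>i j. i < j \<Longrightarrow> j < k \<Longrightarrow> colourable (C i j - K i j) (m i j)" and
    Km: "\<And>i j. i < j \<Longrightarrow> j < k \<Longrightarrow>
      card (K i j) + 2 * m i j \<le> 2 * min (u j) b + (u j + 2 - 2 * b)"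
    by metis
  define B where "B = (\<Union>j<k. \<Union>i<j. K i j)"
  have "K i j \<subseteq> S" if "i < j" "j < k" for i j using KC[OF that] C[OF that] by auto
  then have BS: "B \<subseteq> S" unfolding B_def by (intro UN_least) auto
  have finB: "finite B" using BS fin finite_subset by blast
  have "card B \<le> (\<Sum>j<k. card (\<Union>i<j. K i j))"
    unfolding B_def by (intro card_UN_le) simp
  also have "\<dots> \<le> (\<Sum>j<k. \<Sum>i<j. card (K i j))"
    by (intro sum_mono card_UN_le) simp
  finally have cB: "card B \<le> (\<Sum>j<k. \<Sum>i<j. card (K i j))" .
  have "colourable B ((card B + k) div 2)"
    using cliques_le_mono[OF k BS order_refl] by (rule colourable_half_card[OF finB])
  moreover have "colourable (\<Union>j<k. \<Union>i<j. C i j - K i j) (\<Sum>j<k. \<Sum>i<j. m i j)"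
    using m by (intro colourable_UN) auto
  moreover have "colourable (\<Union>j<k. W j) (\<Sum>j<k. 1)" using W by (intro colourable_UN) auto
  ultimately have "colourable ((\<Union>j<k. W j) \<union> (\<Union>j<k. \<Union>i<j. C i j - K i j) \<union> B)
      ((\<Sum>j<k. 1) + (\<Sum>j<k. \<Sum>i<j. m i j) + (card B + k) div 2)"
    by (intro colourable_Un)
  then have "colourable S ((\<Sum>j<k. 1) + (\<Sum>j<k. \<Sum>i<j. m i j) + (card B + k) div 2)"
    by (rule colourable_mono) (auto simp: S B_def)
  then have "colourable S (k + (\<Sum>j<k. \<Sum>i<j. m i j) + (card B + k) div 2)" by simp
  moreover have "2 * (k + (\<Sum>j<k. \<Sum>i<j. m i j) + (card B + k) div 2)
      \<le> 3 * k + (\<Sum>j<k. j * (2 * min (k + 1 - j) b + (k + 3 - 2 * b - j)))"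
  proof -
    have "(\<Sum>j<k. \<Sum>i<j. card (K i j)) + 2 * (\<Sum>j<k. \<Sum>i<j. m i j)
        = (\<Sum>j<k. \<Sum>i<j. card (K i j) + 2 * m i j)"
      by (simp add: sum.distrib sum_distrib_left)
    also have "\<dots> \<le> (\<Sum>j<k. \<Sum>i<j. 2 * min (u j) b + (u j + 2 - 2 * b))"
      using Km by (intro sum_mono) auto
    also have "\<dots> = (\<Sum>j<k. j * (2 * min (k + 1 - j) b + (k + 3 - 2 * b - j)))"
    proof (intro sum.cong refl)
      fix j assume "j \<in> {..<k}"
      then have "u j + 2 - 2 * b = k + 3 - 2 * b - j" unfolding u_def by simp
      then show "(\<Sum>i<j. 2 * min (u j) b + (u j + 2 - 2 * b))
          = j * (2 * min (k + 1 - j) b + (k + 3 - 2 * b - j))" by (simp add: u_def)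
    qed
    finally have "(\<Sum>j<k. \<Sum>i<j. card (K i j)) + 2 * (\<Sum>j<k. \<Sum>i<j. m i j)
        \<le> (\<Sum>j<k. j * (2 * min (k + 1 - j) b + (k + 3 - 2 * b - j)))" .
    moreover have "2 * ((card B + k) div 2) \<le> card B + k" by simp
    moreover have "2 * (k + y + h) \<le> 3 * k + w"
      if "x + 2 * y \<le> w" "2 * h \<le> z + k" "z \<le> x" for h w x y z :: nat
      using that by arith
    ultimately show ?thesis using cB by blast
  qed
  ultimately show thesis by (rule that)
qed

end

section \<open>Comparison of the bounds\<close>

text \<open>Both bounds are compared with \<open>B_exp\<close> for \<open>b\<close> equal to \<open>k/3\<close> rounded up. With
  \<open>b = t + 2\<close>, the difference is in each residue class of \<open>k\<close> modulo 3 a polynomial in \<open>t\<close> with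
  positive coefficients. The leading terms of the two bounds are
  \<open>10 k\<^sup>3 / 81\<close> and \<open>13 k\<^sup>3 / 108\<close>, both below \<open>208 k\<^sup>3 / 1674\<close>.\<close>

lemma nearly_complete_bound_le_B_exp:
  fixes k b p :: nat
  assumes "k = 3 * b \<or> k + 1 = 3 * b \<or> k + 2 = 3 * b" "2 \<le> b" "p + b = k + 1"
  shows "real (k + (((p + 2) choose 3) + (b - 1) * layer_bound p)) \<le> B_exp k"
proof -
  obtain t where t: "b = t + 2" using assms(2) by (metis add.commute le_Suc_ex)
  have tb: "2 * real (layer_bound p) = real p ^ 2 + 9 * real p"
    using arg_cong[OF layer_bound_double[of p], of real] by (simp add: power2_eq_square)
  have "6 * real (k + (((p + 2) choose 3) + (b - 1) * layer_bound p))
      = 6 * real k + 6 * real ((p + 2) choose 3) + 3 * (real t + 1) * (2 * real (layer_bound p))"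
    using t by (simp add: algebra_simps)
  also have "\<dots> = 6 * real k + (real p + 2) * (real p + 1) * real p
      + 3 * (real t + 1) * (real p ^ 2 + 9 * real p)"
    unfolding real_choose_three tb ..
  finally have *: "6 * real (k + (((p + 2) choose 3) + (b - 1) * layer_bound p))
      = 6 * real k + (real p + 2) * (real p + 1) * real p
        + 3 * (real t + 1) * (real p ^ 2 + 9 * real p)" .
  have pos: "0 \<le> real t" "0 \<le> real t ^ 2" "0 \<le> real t ^ 3" by simp_all
  consider "real k = 3 * real t + 6" | "real k = 3 * real t + 5" | "real k = 3 * real t + 4"
    using assms(1) t by linarith
  then have "1674 * (6 * real k + (real p + 2) * (real p + 1) * real p
        + 3 * (real t + 1) * (real p ^ 2 + 9 * real p))
      \<le> 6 * (208 * real k ^ 3 + 3615 * real k ^ 2 - 871 * real k - 1278)"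
  proof cases
    case 1
    then have p: "real p = 2 * real t + 5" using assms(3) t by linarith
    show ?thesis unfolding 1 p using pos by (simp add: algebra_simps power2_eq_square power3_eq_cube)
  next
    case 2
    then have p: "real p = 2 * real t + 4" using assms(3) t by linarith
    show ?thesis unfolding 2 p using pos by (simp add: algebra_simps power2_eq_square power3_eq_cube)
  next
    case 3
    then have p: "real p = 2 * real t + 3" using assms(3) t by linarith
    show ?thesis unfolding 3 p using pos by (simp add: algebra_simps power2_eq_square power3_eq_cube)
  qed
  then show ?thesis using * unfolding B_exp_def by simp
qed

lemma pair_sum_eq:
  assumes "2 \<le> b" "b \<le> k" "2 * b \<le> k + 3"
  shows "6 * real (\<Sum>j<k. j * (2 * min (k + 1 - j) b + (k + 3 - 2 * b - j)))
    = 2 * ((real k + 1) ^ 3 - (real k + 1)) - 12 * real k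
      - 2 * ((real k + 1 - real b) ^ 3 - (real k + 1 - real b))
      + ((real k + 3 - 2 * real b) ^ 3 - (real k + 3 - 2 * real b))"
proof -
  let ?t = "\<lambda>m. \<Sum>j<k. j * (m - j)"
  have t: "6 * real (?t m) = real m ^ 3 - real m" if "m \<le> k" for m
    using sum_mult_diff[OF that] .
  have t': "6 * real (?t (k + 1)) = (real k + 1) ^ 3 - (real k + 1) - 6 * real k"
    using sum_mult_diff[of "k + 1" "Suc k"] by (simp add: algebra_simps)
  have "(\<Sum>j<k. j * (2 * min (k + 1 - j) b + (k + 3 - 2 * b - j))) + 2 * ?t (k + 1 - b)
      = 2 * ?t (k + 1) + ?t (k + 3 - 2 * b)"
    unfolding sum_distrib_left sum.distrib[symmetric]
  proof (intro sum.cong refl)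
    fix j assume "j \<in> {..<k}"
    \<comment> \<open>A minimum is the full term less its truncated excess; every sum is then a cubic.\<close>
    have "2 * min (k + 1 - j) b + 2 * (k + 1 - b - j) = 2 * (k + 1 - j)" by linarith
    then have "j * (2 * min (k + 1 - j) b + 2 * (k + 1 - b - j)) = j * (2 * (k + 1 - j))"
      by (simp only:)
    then show "j * (2 * min (k + 1 - j) b + (k + 3 - 2 * b - j)) + 2 * (j * (k + 1 - b - j))
        = 2 * (j * (k + 1 - j)) + j * (k + 3 - 2 * b - j)"
      by (simp add: distrib_left)
  qed
  then have "real (\<Sum>j<k. j * (2 * min (k + 1 - j) b + (k + 3 - 2 * b - j)))
      = 2 * real (?t (k + 1)) + real (?t (k + 3 - 2 * b)) - 2 * real (?t (k + 1 - b))"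
    by linarith
  moreover have "real (k + 1 - b) = real k + 1 - real b" using assms by (simp add: of_nat_diff)
  then have "6 * real (?t (k + 1 - b)) = (real k + 1 - real b) ^ 3 - (real k + 1 - real b)"
    using t[of "k + 1 - b"] assms(1) by (simp del: of_nat_sum)
  moreover have "real (k + 3 - 2 * b) = real k + 3 - 2 * real b"
    using assms by (simp add: of_nat_diff)
  then have "6 * real (?t (k + 3 - 2 * b))
      = (real k + 3 - 2 * real b) ^ 3 - (real k + 3 - 2 * real b)"
    using t[of "k + 3 - 2 * b"] assms(1) by (simp del: of_nat_sum)
  moreover have "6 * x = 2 * (6 * y) + 6 * z - 2 * (6 * w)"
    if "x = 2 * y + z - 2 * w" for x y z w :: real using that by simp
  ultimately show ?thesis using t' by (simp only:) simp
qed

lemma halved_bound_le_B_exp: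
  fixes k b N :: nat
  assumes "k = 3 * b \<or> k + 1 = 3 * b \<or> k + 2 = 3 * b" "2 \<le> b"
    and N: "2 * N \<le> 3 * k + (\<Sum>j<k. j * (2 * min (k + 1 - j) b + (k + 3 - 2 * b - j)))"
  shows "real N \<le> B_exp k"
proof -
  obtain t where t: "b = t + 2" using assms(2) by (metis add.commute le_Suc_ex)
  have "2 * real N
      \<le> 3 * real k + real (\<Sum>j<k. j * (2 * min (k + 1 - j) b + (k + 3 - 2 * b - j)))"
    using N by linarith
  moreover have "b \<le> k" "2 * b \<le> k + 3" using assms(1,2) by auto
  note pair_sum_eq[OF assms(2) this]
  ultimately have N': "12 * real N \<le> 18 * real k
      + (2 * ((real k + 1) ^ 3 - (real k + 1)) - 12 * real k
      - 2 * ((real k + 1 - real b) ^ 3 - (real k + 1 - real b))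
      + ((real k + 3 - 2 * real b) ^ 3 - (real k + 3 - 2 * real b)))" (is "_ \<le> ?R")
    by linarith
  have pos: "0 \<le> real t" "0 \<le> real t ^ 2" "0 \<le> real t ^ 3" by simp_all
  have b: "real b = real t + 2" using t by simp
  consider "real k = 3 * real t + 6" | "real k = 3 * real t + 5" | "real k = 3 * real t + 4"
    using assms(1) t by linarith
  then have "1674 * ?R \<le> 12 * (208 * real k ^ 3 + 3615 * real k ^ 2 - 871 * real k - 1278)"
  proof cases
    case 1
    show ?thesis unfolding 1 b using pos by (simp add: algebra_simps power2_eq_square power3_eq_cube)
  next
    case 2
    show ?thesis unfolding 2 b using pos by (simp add: algebra_simps power2_eq_square power3_eq_cube)
  next
    case 3
    show ?thesis unfolding 3 b using pos by (simp add: algebra_simps power2_eq_square power3_eq_cube)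
  qed
  then show ?thesis using N' unfolding B_exp_def by simp
qed

lemma B_exp_less_U8_iff:
  assumes "8 \<le> k"
  shows "B_exp k < U8 k \<longleftrightarrow> 1222 \<le> k"
proof -
  define r where "r = real k"
  define c where "c = (if odd k then 63702 - 24137 * r else 58680 - 23300 * r)"
  have diff: "6696 * (U8 k - B_exp k) = r ^ 2 * (5 * r - 6090) + c"
    using real_choose_three[of k]
    unfolding U8_def B_exp_def S_term_def c_def r_def
    by (simp add: field_simps power2_eq_square power3_eq_cube)
  have r8: "8 \<le> r" using assms by (simp add: r_def)
  show ?thesis
  proof
    assume less: "B_exp k < U8 k"
    show "1222 \<le> k"
    proof (rule ccontr)
      assume "\<not> 1222 \<le> k"
      then have r: "r \<le> 1221" by (simp add: r_def)
      have "r ^ 2 * (5 * r - 6090) + c \<le> 0"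
      \<comment> \<open>Since \<open>6090 = 5 * 1218\<close>, the cubic part is positive only for the last few \<open>r\<close>.\<close>
      proof (cases "r \<le> 1218")
        case True
        then have "r ^ 2 * (5 * r - 6090) \<le> 0" by (intro mult_nonneg_nonpos) auto
        then show ?thesis using r8 by (simp add: c_def)
      next
        case False
        have "r ^ 2 * (5 * r - 6090) \<le> r ^ 2 * 15" using r by (intro mult_left_mono) auto
        moreover have "r ^ 2 \<le> 1221 * r"
          using r r8 by (simp add: power2_eq_square mult_right_mono)
        ultimately have "r ^ 2 * (5 * r - 6090) \<le> 18315 * r" by linarith
        then show ?thesis using False by (simp add: c_def)
      qed
      moreover have "0 < 6696 * (U8 k - B_exp k)" using less by simp
      ultimately show False using diff by linarith
    qed
  next
    assume "1222 \<le> k"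
    then have r: "1222 \<le> r" by (simp add: r_def)
    have "r ^ 2 * 20 \<le> r ^ 2 * (5 * r - 6090)" using r by (intro mult_left_mono) auto
    moreover have "1222 * r \<le> r ^ 2" using r by (simp add: power2_eq_square mult_right_mono)
    ultimately have "24440 * r \<le> r ^ 2 * (5 * r - 6090)" by linarith
    then have "0 < r ^ 2 * (5 * r - 6090) + c" using r by (simp add: c_def)
    then have "0 < 6696 * (U8 k - B_exp k)" using diff by simp
    then show "B_exp k < U8 k" by simp
  qed
qed

context P2_P3_free_adjacency
begin

lemma ex_colourable_le_B_exp:
  assumes fin: "finite S" and k: "cliques_le S k" and A: "A \<subseteq> S" "is_clique A" "card A = k"
    and k2: "2 \<le> k"
  obtains N where "colourable S N" "real N \<le> B_exp k"
proof (cases "k \<le> 3")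
  \<comment> \<open>For these \<open>k\<close> the threshold \<open>b\<close> chosen below could drop to 1, where \<open>Q\<close> has no edge.\<close>
  case True
  have "real ((k + 2) choose 3) \<le> B_exp k"
  proof -
    have "k = 2 \<or> k = 3" using True k2 by linarith
    then show ?thesis using real_choose_three[of k] by (auto simp: B_exp_def)
  qed
  then show thesis using that colourable_choose_three[OF fin k] by blast
next
  case False
  define b where "b = (k + 2) div 3"
  have b: "k = 3 * b \<or> k + 1 = 3 * b \<or> k + 2 = 3 * b" unfolding b_def by linarith
  then have b2: "2 \<le> b" and bk: "b \<le> k" using False by auto
  show thesis
  proof (cases "anticomplete_edges_and_clique S b")
    case True
    have "colourable S (k + (((k + 1 - b + 2) choose 3) + (b - 1) * layer_bound (k + 1 - b)))"
      by (rule colourable_if_anticomplete_edges_and_clique[OF fin k b2 True])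
    moreover have "real (k + (((k + 1 - b + 2) choose 3) + (b - 1) * layer_bound (k + 1 - b)))
        \<le> B_exp k"
      using bk by (intro nearly_complete_bound_le_B_exp[OF b b2]) simp
    ultimately show thesis by (rule that)
  next
    case False
    show thesis
    proof (rule colourable_if_no_anticomplete_edges_and_clique[OF fin k A False])
      fix N assume "colourable S N"
        "2 * N \<le> 3 * k + (\<Sum>j<k. j * (2 * min (k + 1 - j) b + (k + 3 - 2 * b - j)))"
      then show thesis using that halved_bound_le_B_exp[OF b b2] by blast
    qed
  qed
qed

end

section \<open>Induced subgraphs and the theorem\<close>

lemma P2_union_P3_eq: "P2_union_P3 =
  \<lparr> pverts = {Inl 0, Inl 1, Inr 0, Inr 1, Inr 2},
    parcs = {(Inl 0, Inl 1), (Inl 1, Inl 0), (Inr 0, Inr 1), (Inr 1, Inr 0),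
             (Inr 1, Inr 2), (Inr 2, Inr 1)} \<rparr>"
proof -
  have 2: "path_graph 2 = \<lparr> pverts = {0, 1}, parcs = {(0, 1), (1, 0)} \<rparr>"
    unfolding path_graph_def by auto
  have 3: "path_graph 3 = \<lparr> pverts = {0, 1, 2}, parcs = {(0, 1), (1, 0), (1, 2), (2, 1)} \<rparr>"
    unfolding path_graph_def by auto
  show ?thesis
    unfolding P2_union_P3_def disjoint_union_def 2 3 by auto
qed

text \<open>An edge \<open>a b\<close> anticomplete to an induced path \<open>x y z\<close> induces a subgraph isomorphic to
  \<open>P2_union_P3\<close>.\<close>

lemma P2_P3_free_adjacencyI:
  fixes G :: "'a pair_pre_digraph"
  assumes G: "pair_graph G" and free: "free_of P2_union_P3 G"
  shows "P2_P3_free_adjacency (\<lambda>u v. (u, v) \<in> parcs G)"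
proof -
  interpret pair_graph G by (rule G)
  have sym: "(v, u) \<in> parcs G" if "(u, v) \<in> parcs G" for u v
    using pair_sym_arcs that by (auto simp: symmetric_def sym_def)
  have irrefl: "(u, u) \<notin> parcs G" for u using pair_no_loops by fastforce
  interpret simple_adjacency "\<lambda>u v. (u, v) \<in> parcs G"
    using sym irrefl by unfold_locales
  have False if ab: "(a, b) \<in> parcs G" and xy: "(x, y) \<in> parcs G" and yz: "(y, z) \<in> parcs G"
    and xz: "x \<noteq> z" "(x, z) \<notin> parcs G"
    and anti: "\<And>u. u \<in> {x, y, z} \<Longrightarrow> (u, a) \<notin> parcs G \<and> (u, b) \<notin> parcs G" for a b x y z
  proof -
    have anti': "(a, u) \<notin> parcs G \<and> (b, u) \<notin> parcs G" if "u \<in> {x, y, z}" for u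
      using anti[OF that] sym by blast
    define W where "W = \<lparr> pverts = {a, b, x, y, z},
      parcs = {(a, b), (b, a), (x, y), (y, x), (y, z), (z, y)} \<rparr>"
    have ne: "a \<noteq> b" "x \<noteq> y" "y \<noteq> z" "a \<notin> {x, y, z}" "b \<notin> {x, y, z}"
      using ab xy yz irrefl anti anti' sym by blast+
    have zx: "(z, x) \<notin> parcs G" using xz(2) sym by blast
    have V: "{a, b, x, y, z} \<subseteq> pverts G" using ab xy yz wellformed' by blast
    have arcs: "parcs W = {e \<in> parcs G. fst e \<in> {a, b, x, y, z} \<and> snd e \<in> {a, b, x, y, z}}"
    proof -
      have non: "(x, a) \<notin> parcs G" "(y, a) \<notin> parcs G" "(z, a) \<notin> parcs G"
        "(x, b) \<notin> parcs G" "(y, b) \<notin> parcs G" "(z, b) \<notin> parcs G"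
        "(a, x) \<notin> parcs G" "(a, y) \<notin> parcs G" "(a, z) \<notin> parcs G"
        "(b, x) \<notin> parcs G" "(b, y) \<notin> parcs G" "(b, z) \<notin> parcs G"
        using anti anti' by simp_all
      have ne': "a \<noteq> x" "a \<noteq> y" "a \<noteq> z" "b \<noteq> x" "b \<noteq> y" "b \<noteq> z" using ne by simp_all
      have iff: "(u, w) \<in> parcs G \<longleftrightarrow> (u, w) \<in> parcs W"
        if "u \<in> {a, b, x, y, z}" "w \<in> {a, b, x, y, z}" for u w
      proof -
        have "u = a \<or> u = b \<or> u = x \<or> u = y \<or> u = z"
          "w = a \<or> w = b \<or> w = x \<or> w = y \<or> w = z" using that by simp_all
        then show ?thesis
          by (elim disjE; simp add: W_def non ne ne' ne(1-3)[symmetric] ne'[symmetric]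
              xz xz(1)[symmetric] zx irrefl ab xy yz
              sym[OF ab] sym[OF xy] sym[OF yz])
      qed
      have sub: "u \<in> {a, b, x, y, z} \<and> w \<in> {a, b, x, y, z}" if "(u, w) \<in> parcs W" for u w
        using that unfolding W_def by auto
      show ?thesis
      proof (rule set_eqI)
        fix e :: "'a \<times> 'a"
        obtain u w where e: "e = (u, w)" by (cases e)
        show "e \<in> parcs W \<longleftrightarrow>
            e \<in> {e \<in> parcs G. fst e \<in> {a, b, x, y, z} \<and> snd e \<in> {a, b, x, y, z}}"
          unfolding e mem_Collect_eq fst_conv snd_conv using iff[of u w] sub[of u w] by argo
      qed
    qed
    have wf: "wf_digraph (with_proj W)"
      by unfold_locales (auto simp: W_def)
    have "subgraph (with_proj W) (with_proj G)"
      using V wf wf_digraph_axioms arcs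
      by (intro subgraphI) (auto simp: W_def compatible_def)
    then have ind: "induced_subgraph (with_proj W) (with_proj G)"
      using arcs by (intro induced_subgraphI) (auto simp: W_def)
    define f :: "'a \<Rightarrow> nat + nat" where
      "f u = (if u = a then Inl 0 else if u = b then Inl 1 else if u = x then Inr 0
        else if u = y then Inr 1 else Inr 2)" for u
    have f: "f a = Inl 0" "f b = Inl 1" "f x = Inr 0" "f y = Inr 1" "f z = Inr 2"
      using ne xz unfolding f_def by auto
    let ?h = "\<lparr> iso_verts = f, iso_arcs = map_prod f f, iso_head = snd, iso_tail = fst \<rparr>"
    have inj: "inj_on f {a, b, x, y, z}" using f by (auto simp: inj_on_def)
    have "inj_on (map_prod f f) ({a, b, x, y, z} \<times> {a, b, x, y, z})"
      using inj inj by (rule map_prod_inj_on)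
    then have "inj_on (map_prod f f) (parcs W)"
      by (rule inj_on_subset) (auto simp: W_def)
    then have "pre_digraph.digraph_isomorphism (with_proj W) ?h"
      unfolding pre_digraph.digraph_isomorphism_def using wf inj
      by (auto simp: W_def)
    moreover have "with_proj P2_union_P3 = app_iso ?h (with_proj W)"
      unfolding P2_union_P3_eq app_iso_def with_proj_def W_def using f by simp
    ultimately have "digraph_iso (with_proj W) (with_proj P2_union_P3)"
      unfolding digraph_iso_def by blast
    then show False using free ind unfolding free_of_def by blast
  qed
  then show ?thesis
    by unfold_locales (unfold P3_free_def, blast)
qed

theorem theorem1p4:
  shows "(\<forall>G :: 'a pair_pre_digraph.
            pair_graph G \<and> free_of P2_union_P3 G \<and> \<omega> G \<ge> 2
              \<longrightarrow> real (\<chi> G) \<le> B_exp (\<omega> G))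
       \<and> (\<forall>k :: nat. k \<ge> 8 \<longrightarrow> (B_exp k < U8 k \<longleftrightarrow> k \<ge> 1222))"
proof (intro conjI allI impI)
  fix G :: "'a pair_pre_digraph"
  assume G: "pair_graph G \<and> free_of P2_union_P3 G \<and> \<omega> G \<ge> 2"
  interpret pair_graph G using G by blast
  interpret P2_P3_free_adjacency "\<lambda>u v. (u, v) \<in> parcs G"
    using G P2_P3_free_adjacencyI by blast
  let ?V = "pverts G"
  let ?C = "{card K | K. clique G K}"
  have clq: "clique G K \<longleftrightarrow> K \<subseteq> ?V \<and> is_clique K" for K
    unfolding clique_def is_clique_def pairwise_def by blast
  have "?C = card ` {K. clique G K}" by blast
  moreover have "{K. clique G K} \<subseteq> Pow ?V" using clq by blast
  then have "finite {K. clique G K}" using finite_subset pair_finite_verts by blast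
  ultimately have finC: "finite ?C" by simp
  have "clique G {}" by (simp add: clq is_clique_def)
  then have "?C \<noteq> {}" by blast
  then have "\<omega> G \<in> ?C" unfolding clique_number_def using finC by (rule Max_in[rotated])
  then obtain A where A: "A \<subseteq> ?V" "is_clique A" "card A = \<omega> G" using clq by auto
  have "cliques_le ?V (\<omega> G)"
    unfolding cliques_le_def clique_number_def using clq finC by (auto intro!: Max_ge)
  then obtain N where N: "colourable ?V N" "real N \<le> B_exp (\<omega> G)"
    using ex_colourable_le_B_exp[OF pair_finite_verts _ A] G by blast
  have "\<exists>c. proper_colouring G N c"
  proof -
    obtain c where c: "\<forall>v\<in>?V. c v < N" "\<forall>u\<in>?V. \<forall>v\<in>?V. (u, v) \<in> parcs G \<longrightarrow> c u \<noteq> c v"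
      using N(1) unfolding colourable_def by auto
    then have "proper_colouring G N c"
      unfolding proper_colouring_def using wellformed' by blast
    then show ?thesis by (rule exI[of "proper_colouring G N" c])
  qed
  then have "\<chi> G \<le> N" unfolding chromatic_number_def by (rule Least_le)
  then show "real (\<chi> G) \<le> B_exp (\<omega> G)" using N(2) by linarith
next
  fix k :: nat assume "8 \<le> k"
  then show "B_exp k < U8 k \<longleftrightarrow> 1222 \<le> k" by (rule B_exp_less_U8_iff)
qed

end
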